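(* The following assertions are equivalent for a finite simple connected graph $G$ with at least one edge. (i) $G$ is $(2,2)$-tight. (ii) $G$ is an edge-disjoint union of two spanning trees. (iii) $G$ is derivable from $K_4$ by a finite sequence of Henneberg moves and $(2,2)$-tight extension moves.
   Context: For a graph $H$ write $f(H)=2|V(H)|-|E(H)|$. A graph $G$ is $(2,2)$-tight if $f(G)=2$ and $f(H)\ge 2$ for all subgraphs $H$ (with at least one vertex). $K_4$ is the complete graph on four vertices. A graph $(V,E)$ is an edge-disjoint union of two spanning trees if there is a partition $E=E_1\sqcup E_2$ such that $(V,E_1)$ and $(V,E_2)$ are both (connected) trees. Henneberg moves are the Henneberg 1 and Henneberg 2 moves. A Henneberg 1 move $G\to G'$ adds a new vertex of degree two joined by two new edges to two distinct vertices of $G$. A Henneberg 2 move $G\to G'$ removes an edge $v_iv_j$, adds a new vertex $w$ and the edges $v_iw,v_jw$, and adds an edge $wv_k$ to some other vertex $v_k$ of $G$ ($v_k\ne v_i,v_j$). For a subgraph $H$ of $G$, $G/H$ is the multigraph obtained by contracting $H$ to a single vertex $v_*$: its vertex set is $(V(G)\setminus V(H))\cup\{v_*\}$ and its edge set is $(E(G)\setminus E(H))\cup E_*$, with the edges $(v,w)$ of $G$ with $v\notin V(H)$, $w\in V(H)$ replaced by corresponding edges $(v,v_* )$ (forming $E_*$). A $(2,2)$-tight extension move $H\to G$ is an inclusion of a subgraph $H$ in a simple graph $G$ such that $G/H$ is a simple graph and $H$, $G$ and $G/H$ are all $(2,2)$-tight. *)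

theory Defs
  imports Main
begin

record 'a graph =
  verts :: "'a set"
  edges :: "'a set set"

definition simple_graph :: "'a graph \<Rightarrow> bool" where
  "simple_graph G \<longleftrightarrow> finite (verts G) \<and> (\<forall>e\<in>edges G. e \<subseteq> verts G \<and> card e = 2)"

text \<open>Subgraphs need not be induced.\<close>

definition subgraph :: "'a graph \<Rightarrow> 'a graph \<Rightarrow> bool" where
  "subgraph H G \<longleftrightarrow> simple_graph H \<and> verts H \<subseteq> verts G \<and> edges H \<subseteq> edges G"

definition freedom :: "'a graph \<Rightarrow> int" where
  "freedom G = 2 * int (card (verts G)) - int (card (edges G))"

definition tight22 :: "'a graph \<Rightarrow> bool" where
  "tight22 G \<longleftrightarrow> freedom G = 2 \<and>
     (\<forall>H. subgraph H G \<and> verts H \<noteq> {} \<longrightarrow> freedom H \<ge> 2)"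

definition adjacent :: "'a graph \<Rightarrow> 'a \<Rightarrow> 'a \<Rightarrow> bool" where
  "adjacent G u v \<longleftrightarrow> {u, v} \<in> edges G"

definition connected_graph :: "'a graph \<Rightarrow> bool" where
  "connected_graph G \<longleftrightarrow> verts G \<noteq> {} \<and>
     (\<forall>u\<in>verts G. \<forall>v\<in>verts G. (adjacent G)\<^sup>*\<^sup>* u v)"

text \<open>A cycle is given by its list of distinct vertices; the index is taken modulo the
  length so that the last vertex is adjacent to the first.\<close>

definition is_cycle :: "'a graph \<Rightarrow> 'a list \<Rightarrow> bool" where
  "is_cycle G p \<longleftrightarrow> length p \<ge> 3 \<and> distinct p \<and>
     (\<forall>i<length p. adjacent G (p ! i) (p ! (Suc i mod length p)))"

definition is_tree :: "'a graph \<Rightarrow> bool" where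
  "is_tree G \<longleftrightarrow> simple_graph G \<and> connected_graph G \<and> (\<nexists>p. is_cycle G p)"

definition two_spanning_trees :: "'a graph \<Rightarrow> bool" where
  "two_spanning_trees G \<longleftrightarrow>
     (\<exists>E1 E2. edges G = E1 \<union> E2 \<and> E1 \<inter> E2 = {} \<and>
        is_tree \<lparr>verts = verts G, edges = E1\<rparr> \<and>
        is_tree \<lparr>verts = verts G, edges = E2\<rparr>)"

definition is_K4 :: "'a graph \<Rightarrow> bool" where
  "is_K4 G \<longleftrightarrow> card (verts G) = 4 \<and> edges G = {e. e \<subseteq> verts G \<and> card e = 2}"

definition henneberg1 :: "'a graph \<Rightarrow> 'a graph \<Rightarrow> bool" where
  "henneberg1 G G' \<longleftrightarrow>
     (\<exists>w a b. w \<notin> verts G \<and> a \<in> verts G \<and> b \<in> verts G \<and> a \<noteq> b \<and>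
        G' = \<lparr>verts = insert w (verts G), edges = edges G \<union> {{w, a}, {w, b}}\<rparr>)"

definition henneberg2 :: "'a graph \<Rightarrow> 'a graph \<Rightarrow> bool" where
  "henneberg2 G G' \<longleftrightarrow>
     (\<exists>w a b c. w \<notin> verts G \<and> {a, b} \<in> edges G \<and> c \<in> verts G \<and> c \<noteq> a \<and> c \<noteq> b \<and>
        G' = \<lparr>verts = insert w (verts G),
              edges = (edges G - {{a, b}}) \<union> {{a, w}, {b, w}, {w, c}}\<rparr>)"

text \<open>Multigraphs have labelled edges, each with its set of one (for a loop) or two end
  vertices.\<close>

record ('v, 'e) multigraph =
  mverts :: "'v set"
  medges :: "'e set"
  ends :: "'e \<Rightarrow> 'v set"

definition simple_multigraph :: "('v, 'e) multigraph \<Rightarrow> bool" where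
  "simple_multigraph M \<longleftrightarrow> (\<forall>e\<in>medges M. card (ends M e) = 2) \<and> inj_on (ends M) (medges M)"

text \<open>For a simple multigraph this only forgets the labels; in general it would also
  identify parallel edges.\<close>

definition graph_of :: "('v, 'e) multigraph \<Rightarrow> 'v graph" where
  "graph_of M = \<lparr>verts = mverts M, edges = ends M ` medges M\<rparr>"

text \<open>The contraction \<open>G/H\<close>: the vertex \<open>v\<^sub>*\<close> is \<open>None\<close>, and a vertex \<open>v\<close> outside \<open>H\<close> is
  \<open>Some v\<close>. Edges are labelled by the edges of \<open>G\<close> that are not in \<open>H\<close>, so several edges
  from one vertex to \<open>H\<close> become parallel, and an edge of \<open>G\<close> that joins two vertices of \<open>H\<close>
  but is not an edge of \<open>H\<close> becomes a loop at \<open>v\<^sub>*\<close>.\<close>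

definition contract_vertex :: "'a graph \<Rightarrow> 'a \<Rightarrow> 'a option" where
  "contract_vertex H v = (if v \<in> verts H then None else Some v)"

definition contraction :: "'a graph \<Rightarrow> 'a graph \<Rightarrow> ('a option, 'a set) multigraph" where
  "contraction G H =
     \<lparr>mverts = Some ` (verts G - verts H) \<union> {None},
      medges = edges G - edges H,
      ends = (\<lambda>e. contract_vertex H ` e)\<rparr>"

definition extension_move :: "'a graph \<Rightarrow> 'a graph \<Rightarrow> bool" where
  "extension_move H G \<longleftrightarrow> simple_graph G \<and> subgraph H G \<and>
     simple_multigraph (contraction G H) \<and>
     tight22 H \<and> tight22 G \<and> tight22 (graph_of (contraction G H))"

definition construction_move :: "'a graph \<Rightarrow> 'a graph \<Rightarrow> bool" where
  "construction_move G G' \<longleftrightarrow> henneberg1 G G' \<or> henneberg2 G G' \<or> extension_move G G'"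

text \<open>No move deletes a vertex, so all graphs in a derivation of \<open>G\<close> have their vertices
  among those of \<open>G\<close>, and no relabelling of vertices is needed.\<close>

definition derivable_from_K4 :: "'a graph \<Rightarrow> bool" where
  "derivable_from_K4 G \<longleftrightarrow> (\<exists>K. is_K4 K \<and> construction_move\<^sup>*\<^sup>* K G)"

end

theory Submission
  imports Defs
begin

text \<open>
  For a simple graph, \<open>freedom\<close> is least on induced subgraphs, so tightness says that every nonempty
  vertex set \<open>X\<close> induces at most \<open>2 * card X - 2\<close> edges, with equality for the whole vertex set
  (\<open>tight22_iff\<close>). Two disjoint spanning trees give this at once, because a forest on \<open>X\<close> has at most
  \<open>card X - 1\<close> edges (\<open>two_spanning_trees_imp_tight22\<close>). A derivation from \<open>K\<^sub>4\<close> gives it because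
  \<open>K\<^sub>4\<close> is tight and the moves preserve tightness (\<open>derivable_imp_tight22\<close>).

  Both converse directions rest on one reduction, \<open>tight22_cases\<close>: a tight graph with at least two
  vertices is \<open>K\<^sub>4\<close>, or arises from a smaller tight graph by a Henneberg move, or has a proper tight
  vertex set with at least two vertices that can be contracted without creating parallel edges. The
  point is to look first at a largest proper tight set. If there is one, it yields a Henneberg 1 move
  or a contraction. If there is none, then nothing obstructs an inverse Henneberg 2 move at a vertex
  of degree 3, except that its neighbours may be pairwise adjacent, and then the graph is \<open>K\<^sub>4\<close>.

  Derivability follows by induction, since the contraction of a tight set is tight
  (\<open>quotient_tight22\<close>). For the spanning trees the induction splits the edges into two classes, each
  of which connects all vertices. Connected classes combine across a contraction
  (\<open>double_connected_if_quotient\<close>), and counting edges shows at the end that both classes are trees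
  (\<open>two_spanning_trees_if_double_connected\<close>).
\<close>

section \<open>Reachability along edges\<close>

abbreviation joined :: "'a set set \<Rightarrow> 'a \<Rightarrow> 'a \<Rightarrow> bool" where
  "joined E \<equiv> (\<lambda>x y. {x, y} \<in> E)\<^sup>*\<^sup>*"

abbreviation connects :: "'a set set \<Rightarrow> 'a set \<Rightarrow> bool" where
  "connects E V \<equiv> connected_graph \<lparr>verts = V, edges = E\<rparr>"

lemma connects_iff: "connects E V \<longleftrightarrow> V \<noteq> {} \<and> (\<forall>u\<in>V. \<forall>v\<in>V. joined E u v)"
  by (simp add: connected_graph_def adjacent_def[abs_def])

lemma joined_sym: "joined E u v \<Longrightarrow> joined E v u"
proof (induction rule: rtranclp_induct)
  case (step y z)
  then have "{z, y} \<in> E" by (simp add: insert_commute)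
  then show ?case using step.IH by (rule converse_rtranclp_into_rtranclp)
qed simp

lemma joined_edge: "{x, y} \<in> E \<Longrightarrow> joined E x y"
  by (rule r_into_rtranclp)

lemma joined_replace:
  assumes "joined E u v" and "\<And>x y. {x, y} \<in> E \<Longrightarrow> joined E' x y"
  shows "joined E' u v"
  using assms(1)
proof (induction rule: rtranclp_induct)
  case (step y z)
  then show ?case using assms(2)[of y z] rtranclp_trans[of _ u y z] by blast
qed simp

lemma joined_mono: "joined E u v \<Longrightarrow> E \<subseteq> E' \<Longrightarrow> joined E' u v"
  using joined_replace[of E u v E'] joined_edge[of _ _ E'] by blast

lemma connects_rootI:
  assumes "r \<in> V" and "\<And>v. v \<in> V \<Longrightarrow> joined E r v"
  shows "connects E V"
  unfolding connects_iff
proof (intro conjI ballI)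
  fix u v assume "u \<in> V" "v \<in> V"
  then have "joined E u r" "joined E r v" using assms(2) joined_sym[of E r u] by auto
  then show "joined E u v" by (rule rtranclp_trans)
qed (use assms(1) in auto)

lemma connects_insert:
  assumes "connects E V" and "E \<subseteq> E'" and "a \<in> V" and "{a, w} \<in> E'"
  shows "connects E' (insert w V)"
proof (rule connects_rootI[of a])
  fix v assume "v \<in> insert w V"
  then show "joined E' a v"
    using assms joined_edge[of a w E'] joined_mono[of E a v E'] by (auto simp: connects_iff)
qed (use assms in simp)

section \<open>Counting edges in connected and in acyclic graphs\<close>

definition induced :: "'a set set \<Rightarrow> 'a set \<Rightarrow> 'a set set" where
  "induced E X = {e \<in> E. e \<subseteq> X}"

lemma induced_union: "induced (E \<union> F) X = induced E X \<union> induced F X"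
  by (auto simp: induced_def)

lemma joined_leaves:
  assumes "joined E u v" and "u \<in> S" and "v \<notin> S"
  shows "\<exists>x\<in>S. \<exists>y. y \<notin> S \<and> {x, y} \<in> E"
  using assms by (induction rule: rtranclp_induct) auto

text \<open>A vertex set grown one edge at a time from a root carries at least one edge for each vertex
  after the first. Connectedness keeps the growth going until it reaches all of \<open>V\<close>, so a largest
  set with enough induced edges is \<open>V\<close> itself.\<close>

lemma connects_card_le:
  assumes fin: "finite V" "finite E" and E: "\<forall>e\<in>E. e \<subseteq> V" and con: "connects E V"
  shows "card V \<le> card E + 1"
proof -
  let ?P = "\<lambda>S. S \<subseteq> V \<and> S \<noteq> {} \<and> card S \<le> card (induced E S) + 1"
  obtain r where "r \<in> V" using con by (auto simp: connects_iff)
  then have "?P {r}" by simp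
  then obtain S where S: "?P S" and max: "\<And>T. ?P T \<Longrightarrow> card T \<le> card S"
    using ex_has_greatest_nat[of ?P "{r}" card "card V + 1"] card_mono[OF fin(1)]
    by (auto simp: less_Suc_eq_le)
  have "S = V"
  proof (rule ccontr)
    assume "S \<noteq> V"
    then obtain u v where "u \<in> S" "v \<in> V" "v \<notin> S" using S by blast
    moreover have "joined E u v" using calculation con S by (auto simp: connects_iff)
    ultimately obtain x y where xy: "x \<in> S" "y \<notin> S" "{x, y} \<in> E"
      using joined_leaves by metis
    have fS: "finite S" using S fin finite_subset by blast
    have "insert {x, y} (induced E S) \<subseteq> induced E (insert y S)" "{x, y} \<notin> induced E S"
      using xy by (auto simp: induced_def)
    then have "card (induced E S) + 1 \<le> card (induced E (insert y S))"
      using fin card_mono[of "induced E (insert y S)" "insert {x, y} (induced E S)"]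
      by (auto simp: induced_def)
    then have "?P (insert y S)" using S xy E fS by auto
    then show False using max[of "insert y S"] xy fS by simp
  qed
  moreover have "induced E V = E" using E by (auto simp: induced_def)
  ultimately show ?thesis using S by simp
qed

lemma joined_imp_path:
  assumes "joined E u v"
  shows "\<exists>p. p \<noteq> [] \<and> distinct p \<and> hd p = u \<and> last p = v \<and> successively (\<lambda>x y. {x, y} \<in> E) p"
  using assms
proof (induction rule: rtranclp_induct)
  case base
  show ?case by (rule exI[of _ "[u]"]) simp
next
  case (step y z)
  then obtain p where p: "p \<noteq> []" "distinct p" "hd p = u" "last p = y"
    "successively (\<lambda>x y. {x, y} \<in> E) p" by blast
  show ?case
  proof (cases "z \<in> set p")
    case True
    then obtain q r where "p = q @ z # r" by (meson split_list)
    then show ?thesis using p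
      by (intro exI[of _ "q @ [z]"]) (auto simp: successively_append_iff hd_append)
  next
    case False
    then show ?thesis using p step.hyps
      by (intro exI[of _ "p @ [z]"]) (auto simp: successively_append_iff)
  qed
qed

text \<open>A path from \<open>u\<close> to \<open>v\<close> that avoids the edge \<open>{u, v}\<close> has at least three vertices, because edges
  are sets and no second edge has these ends; hence it closes up to a cycle.\<close>

lemma bridge_if_acyclic:
  assumes acyc: "\<nexists>p. is_cycle \<lparr>verts = V, edges = E\<rparr> p" and e: "{u, v} \<in> E" "u \<noteq> v"
  shows "\<not> joined (E - {{u, v}}) u v"
proof
  let ?A = "\<lambda>x y. {x, y} \<in> E - {{u, v}}"
  assume "joined (E - {{u, v}}) u v"
  then obtain p where p: "p \<noteq> []" "distinct p" "hd p = u" "last p = v" "successively ?A p"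
    using joined_imp_path by metis
  have nth: "?A (p ! i) (p ! Suc i)" if "Suc i < length p" for i
    using p(5) that by (simp add: successively_conv_nth)
  have ends: "p ! 0 = u" "p ! (length p - 1) = v"
    using p by (auto simp: hd_conv_nth last_conv_nth)
  have "length p \<noteq> 0" "length p \<noteq> 1" using p e ends by auto
  moreover have "length p \<noteq> 2" using nth[of 0] ends by auto
  ultimately have len: "length p \<ge> 3" by linarith
  have "{p ! i, p ! (Suc i mod length p)} \<in> E" if "i < length p" for i
  proof (cases "Suc i < length p")
    case True
    then show ?thesis using nth by simp
  next
    case False
    then have "Suc i = length p" using that by simp
    then have "i = length p - 1" "Suc i mod length p = 0" by auto
    then show ?thesis using ends e by (simp add: insert_commute)
  qed
  then have "is_cycle \<lparr>verts = V, edges = E\<rparr> p"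
    using len p by (simp add: is_cycle_def adjacent_def)
  then show False using acyc by blast
qed

text \<open>Every edge \<open>{u, v}\<close> is a bridge. Its removal splits the vertices into the component \<open>C\<close> of \<open>u\<close>
  and the rest, which contains \<open>v\<close>, with no edge between them, so induction on the number of edges
  applies to both sides. Cycles refer to a separate vertex set \<open>W\<close>, which stays the same while the
  induction shrinks \<open>V\<close>.\<close>

lemma acyclic_card_less:
  assumes "finite V" "finite E" "V \<noteq> {}" "\<forall>e\<in>E. e \<subseteq> V \<and> card e = 2"
    and "\<nexists>p. is_cycle \<lparr>verts = W, edges = E\<rparr> p"
  shows "card E < card V"
  using assms
proof (induction "card E" arbitrary: V E rule: less_induct)
  case less
  show ?case
  proof (cases "E = {}")
    case True
    then show ?thesis using less.prems by (simp add: card_gt_0_iff)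
  next
    case False
    then obtain e where "e \<in> E" by blast
    then obtain u v where uv: "{u, v} \<in> E" "u \<noteq> v" "u \<in> V" "v \<in> V"
      using less.prems(4) by (metis card_2_iff insert_subset)
    let ?E = "E - {{u, v}}"
    define C where "C = {x \<in> V. joined ?E u x}"
    have C: "u \<in> C" "v \<in> V - C" "C \<subseteq> V"
      using uv bridge_if_acyclic[OF less.prems(5) uv(1,2)] by (auto simp: C_def)
    have part: "card (induced ?E D) < card D" if D: "D \<subseteq> V" "D \<noteq> {}" for D
    proof (rule less.hyps)
      have "induced ?E D \<subset> E" using uv by (auto simp: induced_def)
      then show "card (induced ?E D) < card E" using less.prems(2) psubset_card_mono by blast
      show "finite D" using D less.prems(1) finite_subset by blast
      show "\<nexists>p. is_cycle \<lparr>verts = W, edges = induced ?E D\<rparr> p"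
        using less.prems(5) by (auto simp: is_cycle_def adjacent_def induced_def)
    qed (use D less.prems in \<open>auto simp: induced_def\<close>)
    have "?E \<subseteq> induced ?E C \<union> induced ?E (V - C)"
    proof
      fix f assume f: "f \<in> ?E"
      then obtain x y where xy: "f = {x, y}" "x \<in> V" "y \<in> V"
        using less.prems(4) by (metis DiffD1 card_2_iff insert_subset)
      have "joined ?E x y" "joined ?E y x" 
        using f xy(1) joined_edge[of x y ?E] joined_edge[of y x ?E] by (auto simp: insert_commute)
      then have "x \<in> C \<longleftrightarrow> y \<in> C" using xy
        unfolding C_def by (auto dest: rtranclp_trans)
      then show "f \<in> induced ?E C \<union> induced ?E (V - C)"
        using f xy by (auto simp: induced_def)
    qed
    moreover have "finite (induced ?E C \<union> induced ?E (V - C))"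
      using less.prems(2) by (simp add: induced_def)
    ultimately have "card ?E \<le> card (induced ?E C) + card (induced ?E (V - C))"
      by (meson card_Un_le card_mono order_trans)
    moreover have "card (induced ?E C) < card C" "card (induced ?E (V - C)) < card (V - C)"
      using part C by auto
    moreover have "card V = card C + card (V - C)"
      using C less.prems(1) by (metis card_Diff_subset card_mono finite_subset le_add_diff_inverse)
    moreover have "card E = card ?E + 1"
      using uv less.prems(2) by (metis One_nat_def Suc_eq_plus1 card_Suc_Diff1)
    ultimately show ?thesis by linarith
  qed
qed

text \<open>With the least possible number of edges for a connected graph, no edge can be spared. An edge
  of a cycle can be, as the rest of the cycle joins its ends.\<close>

lemma acyclic_if_connects:
  assumes fin: "finite V" "finite E" and E: "\<forall>e\<in>E. e \<subseteq> V" and con: "connects E V"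
    and card: "card V = card E + 1"
  shows "\<nexists>p. is_cycle \<lparr>verts = V, edges = E\<rparr> p"
proof
  assume "\<exists>p. is_cycle \<lparr>verts = V, edges = E\<rparr> p"
  then obtain p where len: "length p \<ge> 3" and dist: "distinct p"
    and adj: "\<And>i. i < length p \<Longrightarrow> {p ! i, p ! (Suc i mod length p)} \<in> E"
    by (auto simp: is_cycle_def adjacent_def)
  let ?n = "length p - 1"
  let ?e = "{p ! ?n, p ! 0}"
  have e: "?e \<in> E" using adj[of ?n] len by (cases "length p") auto
  have walk: "joined (E - {?e}) (p ! 0) (p ! i)" if "i \<le> ?n" for i
    using that
  proof (induction i)
    case (Suc i)
    have "{p ! i, p ! Suc i} \<in> E" using adj[of i] Suc.prems len by auto
    moreover have "p ! i \<noteq> p ! ?n"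
      using nth_eq_iff_index_eq[OF dist, of i ?n] Suc.prems len by linarith
    moreover have "p ! i \<noteq> p ! 0 \<or> p ! Suc i \<noteq> p ! ?n"
      using nth_eq_iff_index_eq[OF dist, of i 0] nth_eq_iff_index_eq[OF dist, of "Suc i" ?n]
        Suc.prems len by linarith
    ultimately have "{p ! i, p ! Suc i} \<in> E - {?e}" by (auto simp: doubleton_eq_iff)
    then show ?case using Suc by (simp add: rtranclp.rtrancl_into_rtrancl)
  qed simp
  have "joined (E - {?e}) x y" if "{x, y} \<in> E" for x y
  proof (cases "{x, y} = ?e")
    case True
    then show ?thesis using walk[of ?n] joined_sym[OF walk[of ?n]] by (auto simp: doubleton_eq_iff)
  next
    case False
    then show ?thesis using that by (intro joined_edge) simp
  qed
  then have "connects (E - {?e}) V"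
    using con joined_replace[of E _ _ "E - {?e}"] unfolding connects_iff by blast
  then have "card V \<le> card (E - {?e}) + 1" using fin E by (intro connects_card_le) auto
  moreover have "card E = card (E - {?e}) + 1"
    using e fin by (metis One_nat_def Suc_eq_plus1 card_Suc_Diff1)
  ultimately show False using card by simp
qed


section \<open>Tightness in terms of induced edges\<close>

definition sparse22 :: "'a set \<Rightarrow> 'a set set \<Rightarrow> bool" where
  "sparse22 V E \<longleftrightarrow> (\<forall>X\<subseteq>V. X \<noteq> {} \<longrightarrow> card (induced E X) + 2 \<le> 2 * card X)"

lemma finite_edges: "simple_graph G \<Longrightarrow> finite (edges G)"
  by (rule finite_subset[of _ "Pow (verts G)"]) (auto simp: simple_graph_def)

lemma finite_induced: "finite E \<Longrightarrow> finite (induced E X)"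
  by (simp add: induced_def)

lemma induced_verts: "simple_graph G \<Longrightarrow> induced (edges G) (verts G) = edges G"
  by (auto simp: induced_def simple_graph_def)

text \<open>Among the subgraphs on a given vertex set the induced one has the least freedom, so the
  condition on all subgraphs is a condition on vertex sets. Adding 2 on the left instead of
  subtracting it on the right keeps the counts in the natural numbers.\<close>

lemma tight22_iff:
  assumes G: "simple_graph G"
  shows "tight22 G \<longleftrightarrow>
    card (edges G) + 2 = 2 * card (verts G) \<and> sparse22 (verts G) (edges G)"
proof -
  have fin: "finite (verts G)" "finite (edges G)"
    using G finite_edges by (auto simp: simple_graph_def)
  have 1: "freedom H \<ge> 2"
    if sp: "sparse22 (verts G) (edges G)" and H: "subgraph H G" "verts H \<noteq> {}" for H
  proof -
    have "edges H \<subseteq> induced (edges G) (verts H)"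
      using H by (auto simp: subgraph_def simple_graph_def induced_def)
    then have "card (edges H) \<le> card (induced (edges G) (verts H))"
      by (rule card_mono[rotated]) (simp add: finite_induced fin)
    moreover have "card (induced (edges G) (verts H)) + 2 \<le> 2 * card (verts H)"
      using sp H by (auto simp: sparse22_def subgraph_def)
    ultimately show ?thesis by (simp add: freedom_def)
  qed
  have 2: "card (induced (edges G) X) + 2 \<le> 2 * card X"
    if all: "\<forall>H. subgraph H G \<and> verts H \<noteq> {} \<longrightarrow> freedom H \<ge> 2"
      and X: "X \<subseteq> verts G" "X \<noteq> {}" for X
  proof -
    let ?H = "\<lparr>verts = X, edges = induced (edges G) X\<rparr>"
    have "subgraph ?H G"
      using G finite_subset[OF X(1) fin(1)] X
      by (auto simp: subgraph_def simple_graph_def induced_def)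
    then have "freedom ?H \<ge> 2" using all X by auto
    then show ?thesis by (simp add: freedom_def)
  qed
  have "(\<forall>H. subgraph H G \<and> verts H \<noteq> {} \<longrightarrow> freedom H \<ge> 2) \<longleftrightarrow> sparse22 (verts G) (edges G)"
    using 1 2 unfolding sparse22_def[of "verts G" "edges G"] by blast
  moreover have "freedom G = 2 \<longleftrightarrow> card (edges G) + 2 = 2 * card (verts G)"
    unfolding freedom_def by linarith
  ultimately show ?thesis unfolding tight22_def by blast
qed

section \<open>Two spanning trees and two connected edge classes\<close>

text \<open>Each tree induces at most \<open>card X - 1\<close> edges on \<open>X\<close>, with equality on the whole vertex set.\<close>

lemma two_spanning_trees_imp_tight22:
  assumes G: "simple_graph G" and two: "two_spanning_trees G"
  shows "tight22 G"
proof -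
  have fin: "finite (verts G)" "finite (edges G)"
    using G finite_edges by (auto simp: simple_graph_def)
  obtain E1 E2 where E: "edges G = E1 \<union> E2" "E1 \<inter> E2 = {}"
    and T: "is_tree \<lparr>verts = verts G, edges = E1\<rparr>" "is_tree \<lparr>verts = verts G, edges = E2\<rparr>"
    using two by (auto simp: two_spanning_trees_def)
  have forest: "card (induced F X) < card X"
    if F: "is_tree \<lparr>verts = verts G, edges = F\<rparr>" and X: "X \<subseteq> verts G" "X \<noteq> {}" for F X
  proof (rule acyclic_card_less)
    show "finite X" using X fin finite_subset by blast
    show "finite (induced F X)"
      using F finite_edges[of "\<lparr>verts = verts G, edges = F\<rparr>"]
      by (simp add: is_tree_def finite_induced)
    show "\<nexists>p. is_cycle \<lparr>verts = verts G, edges = induced F X\<rparr> p"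
      using F by (auto simp: is_tree_def is_cycle_def adjacent_def induced_def)
  qed (use F X in \<open>auto simp: is_tree_def simple_graph_def induced_def\<close>)
  have tree_card: "card (verts G) = card F + 1"
    if F: "is_tree \<lparr>verts = verts G, edges = F\<rparr>" for F
  proof -
    have sF: "simple_graph \<lparr>verts = verts G, edges = F\<rparr>" and con: "connects F (verts G)"
      using F by (auto simp: is_tree_def)
    then have "card F < card (verts G)"
      using forest[OF F order_refl] induced_verts[OF sF] by (simp add: connects_iff)
    moreover have "card (verts G) \<le> card F + 1"
      using connects_card_le[OF fin(1) _ _ con] finite_edges[OF sF] sF
      by (simp add: simple_graph_def)
    ultimately show ?thesis by simp
  qed
  have finE: "finite E1" "finite E2" using fin E by auto
  then have "card (edges G) = card E1 + card E2" using E by (simp add: card_Un_disjoint)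
  then have "card (edges G) + 2 = 2 * card (verts G)" using T[THEN tree_card] by simp
  moreover have "card (induced (edges G) X) + 2 \<le> 2 * card X"
    if "X \<subseteq> verts G" "X \<noteq> {}" for X
  proof -
    have "card (induced (edges G) X) \<le> card (induced E1 X) + card (induced E2 X)"
      unfolding E induced_union by (rule card_Un_le)
    then show ?thesis using forest[OF T(1) that] forest[OF T(2) that] by simp
  qed
  ultimately show ?thesis by (simp add: tight22_iff[OF G] sparse22_def)
qed

text \<open>Two spanning trees with acyclicity left out. For an edge set of the right size it comes for
  free, and connectedness alone is easier to carry through a construction.\<close>

definition double_connected :: "'a graph \<Rightarrow> bool" where
  "double_connected G \<longleftrightarrow> (\<exists>E1 E2. edges G = E1 \<union> E2 \<and> E1 \<inter> E2 = {} \<and>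
     connects E1 (verts G) \<and> connects E2 (verts G))"

lemma double_connectedI:
  assumes "edges G = E1 \<union> E2" and "E1 \<inter> E2 = {}"
    and "connects E1 (verts G)" and "connects E2 (verts G)"
  shows "double_connected G"
  unfolding double_connected_def using assms by blast

text \<open>Each class has at least \<open>card (verts G) - 1\<close> edges, and together they have exactly twice that
  many. So both bounds are attained, which rules out cycles.\<close>

lemma two_spanning_trees_if_double_connected:
  assumes G: "simple_graph G" and card: "card (edges G) + 2 = 2 * card (verts G)"
    and dc: "double_connected G"
  shows "two_spanning_trees G"
proof -
  have fin: "finite (verts G)" "finite (edges G)"
    using G finite_edges by (auto simp: simple_graph_def)
  obtain E1 E2 where E: "edges G = E1 \<union> E2" "E1 \<inter> E2 = {}"
    and con: "connects E1 (verts G)" "connects E2 (verts G)"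
    using dc by (auto simp: double_connected_def)
  have finE: "finite E1" "finite E2" using fin E by auto
  have sub: "\<forall>e\<in>E1. e \<subseteq> verts G" "\<forall>e\<in>E2. e \<subseteq> verts G"
    using G E by (auto simp: simple_graph_def)
  have "card (edges G) = card E1 + card E2" using E finE by (simp add: card_Un_disjoint)
  then have "card (verts G) = card E1 + 1" "card (verts G) = card E2 + 1"
    using card connects_card_le[OF fin(1) finE(1) sub(1) con(1)]
      connects_card_le[OF fin(1) finE(2) sub(2) con(2)] by auto
  then have "\<nexists>p. is_cycle \<lparr>verts = verts G, edges = E1\<rparr> p"
    "\<nexists>p. is_cycle \<lparr>verts = verts G, edges = E2\<rparr> p"
    using acyclic_if_connects fin finE sub con by metis+
  then show ?thesis
    using E con G unfolding two_spanning_trees_def is_tree_def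
    by (intro exI[of _ E1] exI[of _ E2]) (auto simp: simple_graph_def)
qed

section \<open>The moves preserve tightness\<close>

lemma simple_graph_insert_vertex:
  assumes "finite V" and "\<forall>e\<in>E. e \<subseteq> V \<and> card e = 2"
    and "\<forall>f\<in>N. \<exists>v\<in>V. f = {w, v} \<and> v \<noteq> w"
  shows "simple_graph \<lparr>verts = insert w V, edges = E \<union> N\<rparr>"
  using assms unfolding simple_graph_def by auto

lemma henneberg1_simple:
  assumes "henneberg1 G G'" and "simple_graph G"
  shows "simple_graph G'"
proof -
  obtain w a b where "w \<notin> verts G" "a \<in> verts G" "b \<in> verts G"
    and G': "G' = \<lparr>verts = insert w (verts G), edges = edges G \<union> {{w, a}, {w, b}}\<rparr>"
    using assms(1) by (auto simp: henneberg1_def)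
  then show ?thesis
    unfolding G' using assms(2) by (intro simple_graph_insert_vertex) (auto simp: simple_graph_def)
qed

lemma henneberg2_simple:
  assumes "henneberg2 G G'" and "simple_graph G"
  shows "simple_graph G'"
proof -
  obtain w a b c where w: "w \<notin> verts G" and e: "{a, b} \<in> edges G" and c: "c \<in> verts G"
    and G': "G' = \<lparr>verts = insert w (verts G),
                   edges = (edges G - {{a, b}}) \<union> {{a, w}, {b, w}, {w, c}}\<rparr>"
    using assms(1) unfolding henneberg2_def by blast
  have ab: "a \<in> verts G" "b \<in> verts G" using assms(2) e by (auto simp: simple_graph_def)
  have "\<exists>v\<in>verts G. f = {w, v} \<and> v \<noteq> w" if "f \<in> {{a, w}, {b, w}, {w, c}}" for f
    using that w ab c by blast
  then show ?thesis
    unfolding G' using assms(2)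
    by (intro simple_graph_insert_vertex) (auto simp: simple_graph_def)
qed

text \<open>Common part of the two Henneberg moves: \<open>N\<close> are the edges at the new vertex \<open>w\<close>, and \<open>E\<close> the
  old edges that remain. One more vertex raises the bound on \<open>insert w X\<close> to \<open>2 * card X\<close>, which
  is the form of \<open>ext\<close>. For empty \<open>X\<close> the set is \<open>{w}\<close>, which spans no edge.\<close>

lemma sparse22_insert_vertex:
  assumes fin: "finite V" and w: "w \<notin> V" and E: "{} \<notin> E" "\<forall>e\<in>E. e \<subseteq> V"
    and sp: "sparse22 V E" and N: "\<forall>e\<in>N. w \<in> e \<and> e \<noteq> {w}"
    and ext: "\<And>X. X \<subseteq> V \<Longrightarrow> X \<noteq> {} \<Longrightarrow>
        card (induced E X) + card (induced N (insert w X)) \<le> 2 * card X"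
  shows "sparse22 (insert w V) (E \<union> N)"
  unfolding sparse22_def
proof (intro allI impI)
  fix Y assume Y: "Y \<subseteq> insert w V" "Y \<noteq> {}"
  show "card (induced (E \<union> N) Y) + 2 \<le> 2 * card Y"
  proof (cases "w \<in> Y")
    case False
    then have "induced (E \<union> N) Y = induced E Y" using N by (auto simp: induced_def)
    then show ?thesis using sp Y False by (auto simp: sparse22_def)
  next
    case True
    define X where "X = Y - {w}"
    have X: "X \<subseteq> V" "Y = insert w X" "w \<notin> X" using Y True by (auto simp: X_def)
    have cY: "card Y = card X + 1" using X finite_subset[OF X(1) fin] by simp
    have iE: "induced E Y = induced E X" using X E w by (auto simp: induced_def)
    show ?thesis
    proof (cases "X = {}")
      case True
      then have "induced E X = {}" "induced N Y = {}"
        using X E N by (auto simp: induced_def)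
      then show ?thesis using cY by (simp add: induced_union iE)
    next
      case False
      have "card (induced (E \<union> N) Y) \<le> card (induced E X) + card (induced N Y)"
        unfolding induced_union iE by (rule card_Un_le)
      then show ?thesis using ext[OF X(1) False] X cY by simp
    qed
  qed
qed

lemma henneberg1_tight22:
  assumes h: "henneberg1 G G'" and G: "simple_graph G" and t: "tight22 G"
  shows "tight22 G'"
proof -
  obtain w a b where w: "w \<notin> verts G" and ab: "a \<in> verts G" "b \<in> verts G" "a \<noteq> b"
    and G': "G' = \<lparr>verts = insert w (verts G), edges = edges G \<union> {{w, a}, {w, b}}\<rparr>"
    using h by (auto simp: henneberg1_def)
  let ?N = "{{w, a}, {w, b}}"
  have fin: "finite (verts G)" "finite (edges G)"
    and E: "\<forall>e\<in>edges G. e \<subseteq> verts G \<and> card e = 2"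
    using G finite_edges by (auto simp: simple_graph_def)
  have t': "card (edges G) + 2 = 2 * card (verts G)" "sparse22 (verts G) (edges G)"
    using t tight22_iff[OF G] by auto
  have N: "card ?N = 2" using ab w by (simp add: doubleton_eq_iff)
  have "edges G \<inter> ?N = {}" using E w by auto
  then have "card (edges G \<union> ?N) = card (edges G) + card ?N"
    using fin by (intro card_Un_disjoint) auto
  then have "card (edges G') = card (edges G) + 2" unfolding N by (simp add: G')
  moreover have "card (verts G') = card (verts G) + 1" using w fin by (simp add: G')
  moreover have "sparse22 (insert w (verts G)) (edges G \<union> ?N)"
  proof (rule sparse22_insert_vertex)
    show "{} \<notin> edges G" "\<forall>e\<in>edges G. e \<subseteq> verts G" using E by auto
    show "\<forall>e\<in>?N. w \<in> e \<and> e \<noteq> {w}" using ab w by auto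
    fix X assume "X \<subseteq> verts G" "X \<noteq> {}"
    then have "card (induced (edges G) X) + 2 \<le> 2 * card X"
      using t'(2) by (simp add: sparse22_def)
    moreover have "card (induced ?N (insert w X)) \<le> card ?N"
      by (rule card_mono) (auto simp: induced_def)
    ultimately show "card (induced (edges G) X) + card (induced ?N (insert w X)) \<le> 2 * card X"
      using N by simp
  qed (use fin w t' in auto)
  ultimately show ?thesis
    using t'(1) tight22_iff[OF henneberg1_simple[OF h G]] by (simp add: G')
qed

lemma henneberg2_tight22:
  assumes h: "henneberg2 G G'" and G: "simple_graph G" and t: "tight22 G"
  shows "tight22 G'"
proof -
  obtain w a b c where w: "w \<notin> verts G" and e: "{a, b} \<in> edges G"
    and c: "c \<in> verts G" "c \<noteq> a" "c \<noteq> b"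
    and G': "G' = \<lparr>verts = insert w (verts G),
                   edges = (edges G - {{a, b}}) \<union> {{a, w}, {b, w}, {w, c}}\<rparr>"
    using h unfolding henneberg2_def by blast
  let ?E = "edges G - {{a, b}}"
  let ?N = "{{a, w}, {b, w}, {w, c}}"
  have fin: "finite (verts G)" "finite (edges G)"
    and E: "\<forall>e\<in>edges G. e \<subseteq> verts G \<and> card e = 2"
    using G finite_edges by (auto simp: simple_graph_def)
  have ab: "a \<in> verts G" "b \<in> verts G" "a \<noteq> b" using bspec[OF E e] by auto
  have t': "card (edges G) + 2 = 2 * card (verts G)" "sparse22 (verts G) (edges G)"
    using t tight22_iff[OF G] by auto
  have "{a, w} \<noteq> {b, w}" "{a, w} \<noteq> {w, c}" "{b, w} \<noteq> {w, c}"
    using ab c w by (auto simp: doubleton_eq_iff)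
  then have N: "card ?N = 3" by simp
  have "?E \<inter> ?N = {}" using E w by auto
  then have "card (?E \<union> ?N) = card ?E + card ?N"
    using fin by (intro card_Un_disjoint) auto
  then have "card (edges G') = card ?E + 3" unfolding N by (simp add: G')
  moreover have "card (edges G) = card ?E + 1"
    using e fin by (metis One_nat_def Suc_eq_plus1 card_Suc_Diff1)
  moreover have "card (verts G') = card (verts G) + 1" using w fin by (simp add: G')
  moreover have "sparse22 (insert w (verts G)) (?E \<union> ?N)"
  proof (rule sparse22_insert_vertex)
    show "{} \<notin> ?E" "\<forall>e\<in>?E. e \<subseteq> verts G" using E by auto
    show "\<forall>e\<in>?N. w \<in> e \<and> e \<noteq> {w}" using ab c w by auto
    have mono: "card (induced ?E X) \<le> card (induced (edges G) X)" for X
      by (rule card_mono) (use fin in \<open>auto simp: induced_def\<close>)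
    show "sparse22 (verts G) ?E"
      unfolding sparse22_def
    proof (intro allI impI)
      fix X assume "X \<subseteq> verts G" "X \<noteq> {}"
      then have "card (induced (edges G) X) + 2 \<le> 2 * card X"
        using t'(2) by (simp add: sparse22_def)
      then show "card (induced ?E X) + 2 \<le> 2 * card X" using mono[of X] by linarith
    qed
    fix X assume X: "X \<subseteq> verts G" "X \<noteq> {}"
    then have spX: "card (induced (edges G) X) + 2 \<le> 2 * card X"
      using t'(2) by (simp add: sparse22_def)
    \<comment> \<open>Three new edges count only if \<open>a\<close>, \<open>b\<close> and \<open>c\<close> all lie in \<open>X\<close>; then the deleted edge was in \<open>X\<close> too.\<close>
    show "card (induced ?E X) + card (induced ?N (insert w X)) \<le> 2 * card X"
    proof (cases "a \<in> X \<and> b \<in> X \<and> c \<in> X")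
      case True
      then have "induced ?E X = induced (edges G) X - {{a, b}}" "{a, b} \<in> induced (edges G) X"
        using e by (auto simp: induced_def)
      then have "card (induced (edges G) X) = card (induced ?E X) + 1"
        using finite_induced[OF fin(2)] by (metis One_nat_def Suc_eq_plus1 card_Suc_Diff1)
      moreover have "card (induced ?N (insert w X)) \<le> card ?N"
        by (rule card_mono) (auto simp: induced_def)
      ultimately show ?thesis using spX N by simp
    next
      case False
      have "a \<noteq> w" "b \<noteq> w" "c \<noteq> w" using ab c w by auto
      then have "\<exists>f\<in>?N. \<not> f \<subseteq> insert w X" using False by simp
      then obtain f where "f \<in> ?N" "f \<notin> induced ?N (insert w X)"
        unfolding induced_def by blast
      moreover have "induced ?N (insert w X) \<subseteq> ?N" unfolding induced_def by blast
      ultimately have "induced ?N (insert w X) \<subset> ?N" by blast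
      then have "card (induced ?N (insert w X)) < card ?N"
        by (rule psubset_card_mono[rotated]) simp
      then show ?thesis using spX N mono[of X] by simp
    qed
  qed (use fin w in auto)
  ultimately show ?thesis
    using t'(1) tight22_iff[OF henneberg2_simple[OF h G]] by (simp add: G')
qed

lemma K4_simple: "is_K4 K \<Longrightarrow> simple_graph K"
  by (auto simp: is_K4_def simple_graph_def intro: card_ge_0_finite)

lemma K4_tight22:
  assumes K: "is_K4 K"
  shows "tight22 K"
proof -
  have V: "card (verts K) = 4" and E: "edges K = {e. e \<subseteq> verts K \<and> card e = 2}"
    using K by (auto simp: is_K4_def)
  then have fin: "finite (verts K)" by (auto intro: card_ge_0_finite)
  have "induced (edges K) X = {e. e \<subseteq> X \<and> card e = 2}" if "X \<subseteq> verts K" for X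
    using that E by (auto simp: induced_def)
  then have ind: "card (induced (edges K) X) = card X choose 2" if "X \<subseteq> verts K" for X
    using that n_subsets[of X 2] finite_subset[OF that fin] by simp
  have "sparse22 (verts K) (edges K)"
    unfolding sparse22_def
  proof (intro allI impI)
    fix X assume X: "X \<subseteq> verts K" "X \<noteq> {}"
    have "card X \<le> 4" "card X > 0" 
      using card_mono[OF fin X(1)] finite_subset[OF X(1) fin] X(2) V
      by (auto simp: card_gt_0_iff)
    then have "card X = 1 \<or> card X = 2 \<or> card X = 3 \<or> card X = 4" by linarith
    then show "card (induced (edges K) X) + 2 \<le> 2 * card X"
      using ind[OF X(1)] by (auto simp: choose_two)
  qed
  moreover have "card (edges K) = 6"
    using ind[OF order_refl] induced_verts[OF K4_simple[OF K]] V by (simp add: choose_two)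
  ultimately show ?thesis using V tight22_iff[OF K4_simple[OF K]] by simp
qed

text \<open>An extension move yields a tight graph by definition, so the content is in \<open>K\<^sub>4\<close> and the two
  Henneberg moves.\<close>

lemma derivable_imp_tight22:
  assumes "derivable_from_K4 G"
  shows "tight22 G"
proof -
  obtain K where K: "is_K4 K" "construction_move\<^sup>*\<^sup>* K G"
    using assms by (auto simp: derivable_from_K4_def)
  from K(2) have "simple_graph G \<and> tight22 G"
  proof (induction rule: rtranclp_induct)
    case base
    show ?case using K(1) K4_simple K4_tight22 by blast
  next
    case (step G G')
    then show ?case
      unfolding construction_move_def
      using henneberg1_simple henneberg2_simple henneberg1_tight22 henneberg2_tight22
      by (auto simp: extension_move_def)
  qed
  then show ?thesis by blast
qed

section \<open>Two connected edge classes through the moves\<close>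

text \<open>One new edge goes to each class, so the new vertex hangs as a leaf from both.\<close>

lemma double_connected_henneberg1:
  assumes h: "henneberg1 G G'" and G: "simple_graph G" and dc: "double_connected G"
  shows "double_connected G'"
proof -
  obtain w a b where w: "w \<notin> verts G" and ab: "a \<in> verts G" "b \<in> verts G" "a \<noteq> b"
    and G': "G' = \<lparr>verts = insert w (verts G), edges = edges G \<union> {{w, a}, {w, b}}\<rparr>"
    using h by (auto simp: henneberg1_def)
  obtain E1 E2 where E: "edges G = E1 \<union> E2" "E1 \<inter> E2 = {}"
    and con: "connects E1 (verts G)" "connects E2 (verts G)"
    using dc by (auto simp: double_connected_def)
  have new: "{w, v} \<notin> edges G" for v using G w by (auto simp: simple_graph_def)
  have ne: "{w, a} \<noteq> {w, b}" using ab by (simp add: doubleton_eq_iff)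
  have "connects (insert {w, a} E1) (insert w (verts G))"
    using con(1) ab(1) by (intro connects_insert[where a = a]) (auto simp: insert_commute)
  moreover have "connects (insert {w, b} E2) (insert w (verts G))"
    using con(2) ab(2) by (intro connects_insert[where a = b]) (auto simp: insert_commute)
  moreover have "edges G' = insert {w, a} E1 \<union> insert {w, b} E2" using E by (auto simp: G')
  moreover have "insert {w, a} E1 \<inter> insert {w, b} E2 = {}" using E new ne by blast
  ultimately show ?thesis
    by (intro double_connectedI[where ?E1.0 = "insert {w, a} E1" and ?E2.0 = "insert {w, b} E2"])
      (simp_all add: G')
qed

text \<open>In the class of the deleted edge the path through \<open>w\<close> takes its place; the third new edge
  attaches \<open>w\<close> to the other class as a leaf.\<close>

lemma double_connected_henneberg2:
  assumes h: "henneberg2 G G'" and G: "simple_graph G" and dc: "double_connected G"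
  shows "double_connected G'"
proof -
  obtain w a b c where w: "w \<notin> verts G" and e: "{a, b} \<in> edges G"
    and c: "c \<in> verts G" "c \<noteq> a" "c \<noteq> b"
    and G': "G' = \<lparr>verts = insert w (verts G),
                   edges = (edges G - {{a, b}}) \<union> {{a, w}, {b, w}, {w, c}}\<rparr>"
    using h unfolding henneberg2_def by blast
  obtain E1 E2 where E: "edges G = E1 \<union> E2" "E1 \<inter> E2 = {}" "{a, b} \<in> E1"
    and con: "connects E1 (verts G)" "connects E2 (verts G)"
    using dc e unfolding double_connected_def by (metis Int_commute Un_commute UnE)
  have ab: "a \<in> verts G" "b \<in> verts G" using G e by (auto simp: simple_graph_def)
  have new: "{v, w} \<notin> edges G" "{w, v} \<notin> edges G" for v
    using G w by (auto simp: simple_graph_def)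
  have ne: "{a, w} \<noteq> {w, c}" "{b, w} \<noteq> {w, c}" using c by (auto simp: doubleton_eq_iff)
  let ?F1 = "E1 - {{a, b}} \<union> {{a, w}, {b, w}}"
  let ?F2 = "insert {w, c} E2"
  have aw: "joined ?F1 a w" by (rule joined_edge) simp
  have bw: "joined ?F1 b w" by (rule joined_edge) simp
  have ab_joined: "joined ?F1 a b" using aw joined_sym[OF bw] by (rule rtranclp_trans)
  have edge: "joined ?F1 x y" if "{x, y} \<in> E1" for x y
  proof (cases "{x, y} = {a, b}")
    case True
    then show ?thesis using ab_joined joined_sym[OF ab_joined] by (auto simp: doubleton_eq_iff)
  next
    case False
    then show ?thesis using that by (intro joined_edge) simp
  qed
  have "connects ?F1 (insert w (verts G))"
  proof (rule connects_rootI[of a])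
    fix v assume v: "v \<in> insert w (verts G)"
    show "joined ?F1 a v"
    proof (cases "v = w")
      case False
      then have "joined E1 a v" using v con(1) ab unfolding connects_iff by blast
      then show ?thesis using edge by (rule joined_replace)
    qed (use aw in simp)
  qed (use ab in simp)
  moreover have "connects ?F2 (insert w (verts G))"
    using con(2) c(1) by (intro connects_insert[where a = c]) (auto simp: insert_commute)
  moreover have "edges G' = ?F1 \<union> ?F2" using E by (auto simp: G')
  moreover have "?F1 \<inter> ?F2 = {}" using E new ne by blast
  moreover have "verts G' = insert w (verts G)" by (simp add: G')
  ultimately show ?thesis
    by (intro double_connectedI[where ?E1.0 = ?F1 and ?E2.0 = ?F2]) (simp_all only:)
qed

text \<open>The complement of a Hamiltonian path in \<open>K\<^sub>4\<close> is again a Hamiltonian path.\<close>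

lemma double_connected_K4:
  assumes K: "is_K4 K"
  shows "double_connected K"
proof -
  have "card (verts K) = Suc (Suc (Suc (Suc 0)))" using K by (simp add: is_K4_def)
  then obtain a b c d where V: "verts K = {a, b, c, d}"
    and d: "a \<noteq> b" "a \<noteq> c" "a \<noteq> d" "b \<noteq> c" "b \<noteq> d" "c \<noteq> d"
    by (auto simp: card_Suc_eq)
  have E: "edges K = {e. e \<subseteq> {a, b, c, d} \<and> card e = 2}" using K V by (simp add: is_K4_def)
  have path: "connects {{x, y}, {y, z}, {z, t}} {t, z, y, x}" for x y z t :: 'a
  proof -
    have "connects {} {x}" by (simp add: connects_iff)
    then have "connects {{x, y}} {y, x}" by (rule connects_insert[where a = x]) auto
    then have "connects {{x, y}, {y, z}} {z, y, x}" by (rule connects_insert[where a = y]) auto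
    then show ?thesis by (rule connects_insert[where a = z]) auto
  qed
  let ?E1 = "{{a, b}, {b, c}, {c, d}}" and ?E2 = "{{b, d}, {d, a}, {a, c}}"
  have "edges K = ?E1 \<union> ?E2"
  proof
    show "edges K \<subseteq> ?E1 \<union> ?E2"
    proof
      fix e assume "e \<in> edges K"
      then obtain x y where "e = {x, y}" "x \<noteq> y" "x \<in> {a, b, c, d}" "y \<in> {a, b, c, d}"
        unfolding E by (auto simp: card_2_iff)
      then show "e \<in> ?E1 \<union> ?E2"
        by (elim insertE emptyE) (simp_all add: doubleton_eq_iff)
    qed
    show "?E1 \<union> ?E2 \<subseteq> edges K" unfolding E using d by auto
  qed
  moreover have "?E1 \<inter> ?E2 = {}" using d by (auto simp: doubleton_eq_iff)
  moreover have "{d, c, b, a} = verts K" "{c, a, d, b} = verts K" unfolding V by blast+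
  then have "connects ?E1 (verts K)" "connects ?E2 (verts K)"
    using path[where x = a and y = b and z = c and t = d]
      path[where x = b and y = d and z = a and t = c] by simp_all
  ultimately show ?thesis
    by (intro double_connectedI[where ?E1.0 = ?E1 and ?E2.0 = ?E2])
qed

section \<open>Reducing a tight graph\<close>

definition tight_set :: "'a graph \<Rightarrow> 'a set \<Rightarrow> bool" where
  "tight_set G X \<longleftrightarrow>
     X \<subseteq> verts G \<and> X \<noteq> {} \<and> card (induced (edges G) X) + 2 = 2 * card X"

definition single_links :: "'a graph \<Rightarrow> 'a set \<Rightarrow> bool" where
  "single_links G X \<longleftrightarrow>
     (\<forall>w\<in>verts G - X. \<forall>a\<in>X. \<forall>b\<in>X. {w, a} \<in> edges G \<and> {w, b} \<in> edges G \<longrightarrow> a = b)"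

abbreviation induced_graph :: "'a graph \<Rightarrow> 'a set \<Rightarrow> 'a graph" where
  "induced_graph G X \<equiv> \<lparr>verts = X, edges = induced (edges G) X\<rparr>"

lemma induced_graph_simple:
  assumes "simple_graph G" and "X \<subseteq> verts G"
  shows "simple_graph (induced_graph G X)"
  using assms finite_subset[of X "verts G"] by (auto simp: simple_graph_def induced_def)

lemma induced_graph_tight22:
  assumes G: "simple_graph G" and t: "tight22 G" and X: "tight_set G X"
  shows "tight22 (induced_graph G X)"
proof -
  have sub: "X \<subseteq> verts G" using X by (simp add: tight_set_def)
  have "induced (induced (edges G) X) Y = induced (edges G) Y" if "Y \<subseteq> X" for Y
    using that by (auto simp: induced_def)
  moreover have "sparse22 (verts G) (edges G)" using t tight22_iff[OF G] by simp
  ultimately have "sparse22 X (induced (edges G) X)"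
    using sub by (simp add: sparse22_def)
  then show ?thesis
    using X tight22_iff[OF induced_graph_simple[OF G sub]] by (simp add: tight_set_def)
qed

text \<open>Sparsity forces equality: two edges from \<open>w\<close> into a tight set use up all the freedom that \<open>w\<close>
  adds.\<close>

lemma tight_set_insert:
  assumes G: "simple_graph G" and t: "tight22 G" and X: "tight_set G X"
    and w: "w \<in> verts G" "w \<notin> X" and ab: "a \<in> X" "b \<in> X" "a \<noteq> b"
    and e: "{w, a} \<in> edges G" "{w, b} \<in> edges G"
  shows "tight_set G (insert w X)"
    and "induced (edges G) (insert w X) = induced (edges G) X \<union> {{w, a}, {w, b}}"
proof -
  let ?E = "edges G" and ?N = "{{w, a}, {w, b}}"
  have finE: "finite ?E" using G by (rule finite_edges)
  have finX: "finite X"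
    using G X finite_subset[of X "verts G"] by (auto simp: simple_graph_def tight_set_def)
  have sub: "induced ?E X \<union> ?N \<subseteq> induced ?E (insert w X)"
    using ab e by (auto simp: induced_def)
  have "card ?N = 2" using ab by (simp add: doubleton_eq_iff)
  moreover have "induced ?E X \<inter> ?N = {}" using w by (auto simp: induced_def)
  ultimately have card: "card (induced ?E X \<union> ?N) = card (induced ?E X) + 2"
    using finite_induced[OF finE, of X] card_Un_disjoint[of "induced ?E X" ?N] by simp
  have "sparse22 (verts G) ?E" using t tight22_iff[OF G] by simp
  then have upper: "card (induced ?E (insert w X)) + 2 \<le> 2 * card (insert w X)"
    using w X by (auto simp: sparse22_def tight_set_def)
  have cX: "card (insert w X) = card X + 1" using w finX by simp
  have tX: "card (induced ?E X) + 2 = 2 * card X" using X by (simp add: tight_set_def)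
  have fin': "finite (induced ?E (insert w X))" using finE by (rule finite_induced)
  have le: "card (induced ?E X) + 2 \<le> card (induced ?E (insert w X))"
    using card_mono[OF fin' sub] card by simp
  then have eq: "card (induced ?E (insert w X)) = card (induced ?E X) + 2"
    using upper cX tX by simp
  then show "tight_set G (insert w X)" using w X cX tX by (simp add: tight_set_def)
  show "induced ?E (insert w X) = induced ?E X \<union> ?N"
    using card_subset_eq[OF fin' sub] eq card by simp
qed

lemma is_K4_if_tight22:
  assumes G: "simple_graph G" and t: "tight22 G" and V: "card (verts G) = 4"
  shows "is_K4 G"
proof -
  let ?P = "{e. e \<subseteq> verts G \<and> card e = 2}"
  have fin: "finite (verts G)" using G by (simp add: simple_graph_def)
  have "card (edges G) = 6" using t V tight22_iff[OF G] by simp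
  moreover have "card ?P = 6" using n_subsets[OF fin, of 2] V by (simp add: choose_two)
  moreover have "edges G \<subseteq> ?P" using G by (auto simp: simple_graph_def)
  ultimately have "edges G = ?P"
    using fin by (intro card_subset_eq) auto
  then show ?thesis using V by (simp add: is_K4_def)
qed

lemma edges_at_vertex:
  assumes G: "simple_graph G"
  shows "{e \<in> edges G. v \<in> e} = (\<lambda>x. {v, x}) ` {x \<in> verts G - {v}. {v, x} \<in> edges G}"
    and "card {e \<in> edges G. v \<in> e} = card {x \<in> verts G - {v}. {v, x} \<in> edges G}"
proof -
  let ?N = "{x \<in> verts G - {v}. {v, x} \<in> edges G}"
  show 1: "{e \<in> edges G. v \<in> e} = (\<lambda>x. {v, x}) ` ?N"
  proof
    show "{e \<in> edges G. v \<in> e} \<subseteq> (\<lambda>x. {v, x}) ` ?N"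
    proof
      fix e assume "e \<in> {e \<in> edges G. v \<in> e}"
      then have e: "e \<in> edges G" "v \<in> e" "e \<subseteq> verts G" "card e = 2"
        using G by (auto simp: simple_graph_def)
      then obtain x where "e = {v, x}" "x \<noteq> v" by (auto simp: card_2_iff)
      then show "e \<in> (\<lambda>x. {v, x}) ` ?N" using e by auto
    qed
  qed auto
  have "inj_on (\<lambda>x. {v, x}) ?N" by (auto simp: inj_on_def doubleton_eq_iff)
  then show "card {e \<in> edges G. v \<in> e} = card ?N" unfolding 1 by (rule card_image)
qed

text \<open>The average degree is below 4. Two vertices alone carry too few edges, so there are at least
  three. Removing a vertex of degree at most 2 would leave a tight set of at least two vertices (or
  violate sparsity), and that is excluded; so a vertex of degree below 4 has degree exactly 3.\<close>

lemma degree_3_vertex_exists: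
  assumes G: "simple_graph G" and t: "tight22 G" and V: "card (verts G) \<ge> 2"
    and none: "\<And>X. tight_set G X \<Longrightarrow> X \<noteq> verts G \<Longrightarrow> card X < 2"
  shows "\<exists>v\<in>verts G. card {e \<in> edges G. v \<in> e} = 3"
proof -
  let ?deg = "\<lambda>v. card {e \<in> edges G. v \<in> e}"
  have fin: "finite (verts G)" "finite (edges G)"
    and E: "\<And>e. e \<in> edges G \<Longrightarrow> e \<subseteq> verts G \<and> card e = 2"
    using G finite_edges by (auto simp: simple_graph_def)
  have t': "card (edges G) + 2 = 2 * card (verts G)" "sparse22 (verts G) (edges G)"
    using t tight22_iff[OF G] by auto
  have "card (verts G) \<noteq> 2"
  proof
    assume "card (verts G) = 2"
    then have "e = verts G" if "e \<in> edges G" for e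
      using card_subset_eq[OF fin(1)] E[OF that] by simp
    then have "edges G \<subseteq> {verts G}" by blast
    then have "card (edges G) \<le> 1" using card_mono[of "{verts G}" "edges G"] by simp
    then show False using t' \<open>card (verts G) = 2\<close> by simp
  qed
  then have V3: "card (verts G) \<ge> 3" using V by simp
  have ge: "?deg v \<ge> 3" if v: "v \<in> verts G" for v
  proof -
    let ?X = "verts G - {v}"
    have cX: "card (verts G) = card ?X + 1" using card.remove[OF fin(1) v] by simp
    then have c2: "card ?X \<ge> 2" using V3 by linarith
    then have ne: "?X \<noteq> {}" by fastforce
    have "?X \<noteq> verts G" using v by blast
    note X = Diff_subset[of "verts G" "{v}"] ne this c2
    have "edges G = induced (edges G) ?X \<union> {e \<in> edges G. v \<in> e}"
      using E by (auto simp: induced_def)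
    moreover have "card (induced (edges G) ?X \<union> {e \<in> edges G. v \<in> e}) =
        card (induced (edges G) ?X) + ?deg v"
      using fin by (intro card_Un_disjoint) (auto simp: induced_def)
    ultimately have sum: "card (edges G) = card (induced (edges G) ?X) + ?deg v" by simp
    have "card (induced (edges G) ?X) + 2 \<le> 2 * card ?X"
      using t'(2) X by (simp add: sparse22_def)
    moreover have "\<not> tight_set G ?X" using none[of ?X] X by linarith
    then have "card (induced (edges G) ?X) + 2 \<noteq> 2 * card ?X" using X by (simp add: tight_set_def)
    ultimately show ?thesis using sum t'(1) cX by linarith
  qed
  have "\<exists>v\<in>verts G. ?deg v < 4"
  proof (rule ccontr)
    assume "\<not> (\<exists>v\<in>verts G. ?deg v < 4)"
    then have "4 * card (verts G) \<le> (\<Sum>v\<in>verts G. ?deg v)"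
      using sum_bounded_below[of "verts G" 4 ?deg] by (simp add: not_less mult.commute)
    moreover have "{v \<in> verts G. v \<in> e} = e" if "e \<in> edges G" for e using E[OF that] by auto
    then have "\<forall>e\<in>edges G. card {v \<in> verts G. v \<in> e} = 2" using E by auto
    then have "(\<Sum>v\<in>verts G. ?deg v) = 2 * card (edges G)" by (rule sum_multicount[OF fin])
    ultimately show False using t'(1) by linarith
  qed
  then obtain v where "v \<in> verts G" "?deg v < 4" by blast
  then show ?thesis using ge[of v] by (intro bexI[of _ v]) linarith+
qed

text \<open>The dichotomy is on proper tight sets with at least two vertices. If there is one, take it
  of maximal size. A vertex outside with two neighbours in it could be added to it, which by
  maximality yields all of \<open>G\<close>: a Henneberg 1 move. Otherwise every outside vertex has at most one
  neighbour in it, so contracting it keeps the graph simple.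

  If there is none, remove a vertex of degree 3 and join two of its neighbours that are not
  adjacent. Only a tight set that contains both of them and misses the vertex could obstruct this,
  and that set would be proper. When the three neighbours are pairwise adjacent, they form with the
  vertex a \<open>K\<^sub>4\<close>, which is tight and thus everything.\<close>

lemma tight22_cases:
  assumes G: "simple_graph G" and t: "tight22 G" and V: "card (verts G) \<ge> 2"
  shows "is_K4 G
    \<or> (\<exists>H. simple_graph H \<and> tight22 H \<and> 2 \<le> card (verts H) \<and> card (verts H) < card (verts G) \<and>
          (henneberg1 H G \<or> henneberg2 H G))
    \<or> (\<exists>X. tight_set G X \<and> X \<noteq> verts G \<and> 2 \<le> card X \<and> single_links G X)"
proof (cases "\<exists>X. tight_set G X \<and> X \<noteq> verts G \<and> 2 \<le> card X")
  case True
  let ?P = "\<lambda>X. tight_set G X \<and> X \<noteq> verts G \<and> 2 \<le> card X"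
  have fin: "finite (verts G)" using G by (simp add: simple_graph_def)
  have bound: "card X < card (verts G) + 1" if "?P X" for X
    using that card_mono[OF fin, of X] by (auto simp: tight_set_def)
  obtain X0 where "?P X0" using True by blast
  then obtain X where X: "?P X" and max: "\<And>Y. ?P Y \<Longrightarrow> card Y \<le> card X"
    using ex_has_greatest_nat[of ?P X0 card "card (verts G) + 1"] bound
    by (metis (lifting))
  have Xsub: "X \<subseteq> verts G" using X by (simp add: tight_set_def)
  have less: "card X < card (verts G)" using X Xsub fin by (intro psubset_card_mono) auto
  show ?thesis
  proof (cases "single_links G X")
    case True
    then show ?thesis using X by blast
  next
    case False
    then obtain w a b where wab: "w \<in> verts G" "w \<notin> X" "a \<in> X" "b \<in> X" "a \<noteq> b"
      "{w, a} \<in> edges G" "{w, b} \<in> edges G"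
      by (auto simp: single_links_def)
    note ins = tight_set_insert[OF G t _ wab]
    have "tight_set G (insert w X)" using ins(1) X by simp
    moreover have "card (insert w X) = card X + 1"
      using wab finite_subset[OF Xsub fin] by simp
    ultimately have whole: "verts G = insert w X" using max[of "insert w X"] X by fastforce
    then have "edges G = induced (edges G) X \<union> {{w, a}, {w, b}}"
      using ins(2) X induced_verts[OF G] by simp
    then have "G = \<lparr>verts = insert w X, edges = induced (edges G) X \<union> {{w, a}, {w, b}}\<rparr>"
      using whole by (intro graph.equality) simp_all
    then have "henneberg1 (induced_graph G X) G"
      unfolding henneberg1_def using wab
      by (intro exI[of _ w] exI[of _ a] exI[of _ b]) simp
    moreover have "simple_graph (induced_graph G X)" using G Xsub by (rule induced_graph_simple)
    moreover have "tight22 (induced_graph G X)" using induced_graph_tight22[OF G t] X by simp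
    ultimately show ?thesis using X less by (intro disjI2 disjI1 exI[of _ "induced_graph G X"]) simp
  qed
next
  case False
  then have none: "\<And>X. tight_set G X \<Longrightarrow> X \<noteq> verts G \<Longrightarrow> card X < 2" by (meson not_le)
  have fin: "finite (verts G)" "finite (edges G)"
    and E: "\<And>e. e \<in> edges G \<Longrightarrow> e \<subseteq> verts G \<and> card e = 2"
    using G finite_edges by (auto simp: simple_graph_def)
  have t': "card (edges G) + 2 = 2 * card (verts G)" "sparse22 (verts G) (edges G)"
    using t tight22_iff[OF G] by auto
  obtain v where v: "v \<in> verts G" "card {e \<in> edges G. v \<in> e} = 3"
    using degree_3_vertex_exists[OF G t V none] by blast
  let ?N = "{x \<in> verts G - {v}. {v, x} \<in> edges G}"
  let ?S = "{e \<in> edges G. v \<in> e}"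
  have "card ?N = 3" using v edges_at_vertex(2)[OF G] by simp
  then obtain a b c where N: "?N = {a, b, c}" and d: "a \<noteq> b" "b \<noteq> c" "a \<noteq> c"
    by (auto simp: card_3_iff)
  have S: "?S = {{v, a}, {v, b}, {v, c}}" unfolding edges_at_vertex(1)[OF G] N by simp
  have abc: "a \<in> verts G" "b \<in> verts G" "c \<in> verts G" "a \<noteq> v" "b \<noteq> v" "c \<noteq> v"
    using N by blast+
  have cV: "card (verts G) = card (verts G - {v}) + 1" using card.remove[OF fin(1) v(1)] by simp
  have "card {a, b, c} \<le> card (verts G - {v})" using fin abc by (intro card_mono) auto
  then have V4: "card (verts G - {v}) \<ge> 3" using d by simp
  \<comment> \<open>An inverse Henneberg 2 move at \<open>v\<close>, for two neighbours \<open>x\<close> and \<open>y\<close> that are not adjacent.\<close>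
  have remove: ?thesis
    if xyz: "x \<in> {a, b, c}" "y \<in> {a, b, c}" "z \<in> {a, b, c}" "x \<noteq> y" "z \<noteq> x" "z \<noteq> y"
      "{x, y} \<notin> edges G" for x y z
  proof -
    let ?V = "verts G - {v}"
    let ?E = "insert {x, y} (edges G - ?S)"
    let ?H = "\<lparr>verts = ?V, edges = ?E\<rparr>"
    have xyzV: "x \<in> ?V" "y \<in> ?V" "z \<in> ?V" using xyz abc by auto
    have H: "simple_graph ?H" using fin E xyzV xyz by (auto simp: simple_graph_def)
    have "card (edges G) = card (edges G - ?S) + 3"
      using v(2) fin card_Diff_subset[of ?S "edges G"] card_mono[of "edges G" ?S] by auto
    moreover have "card ?E = card (edges G - ?S) + 1" using fin xyz by simp
    ultimately have cE: "card ?E + 2 = 2 * card ?V" using t'(1) cV by linarith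
    have "sparse22 ?V ?E"
      unfolding sparse22_def
    proof (intro allI impI)
      fix Y assume Y: "Y \<subseteq> ?V" "Y \<noteq> {}"
      have le: "card (induced (edges G) Y) + 2 \<le> 2 * card Y"
        using t'(2) Y by (auto simp: sparse22_def)
      have finI: "finite (induced (edges G) Y)" using fin by (simp add: finite_induced)
      show "card (induced ?E Y) + 2 \<le> 2 * card Y"
      proof (cases "x \<in> Y \<and> y \<in> Y")
        case True
        have "finite Y" using Y fin finite_subset by blast
        then have "card {x, y} \<le> card Y" using True by (intro card_mono) auto
        then have "card Y \<ge> 2" using xyz by simp
        then have "\<not> tight_set G Y" using none[of Y] Y v by force
        then have "card (induced (edges G) Y) + 2 \<noteq> 2 * card Y"
          using Y by (auto simp: tight_set_def)
        moreover have "induced ?E Y \<subseteq> insert {x, y} (induced (edges G) Y)"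
          by (auto simp: induced_def)
        then have "card (induced ?E Y) \<le> card (insert {x, y} (induced (edges G) Y))"
          using finI by (intro card_mono) simp_all
        moreover have "card (insert {x, y} (induced (edges G) Y)) \<le> card (induced (edges G) Y) + 1"
          using finI by (simp add: card_insert_if)
        ultimately show ?thesis using le by linarith
      next
        case False
        then have "induced ?E Y \<subseteq> induced (edges G) Y" by (auto simp: induced_def)
        then have "card (induced ?E Y) \<le> card (induced (edges G) Y)"
          using finI by (intro card_mono)
        then show ?thesis using le by linarith
      qed
    qed
    then have tH: "tight22 ?H" using cE tight22_iff[OF H] by simp
    have S': "{{x, v}, {y, v}, {v, z}} = ?S"
      unfolding S using xyz d by (auto simp: insert_commute)
    have "edges G = (?E - {{x, y}}) \<union> {{x, v}, {y, v}, {v, z}}"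
      unfolding S' using xyz by auto
    then have "G = \<lparr>verts = insert v ?V, edges = (?E - {{x, y}}) \<union> {{x, v}, {y, v}, {v, z}}\<rparr>"
      using v by (intro graph.equality) auto
    then have "henneberg2 ?H G"
      unfolding henneberg2_def using xyz xyzV
      by (intro exI[of _ v] exI[of _ x] exI[of _ y] exI[of _ z]) simp
    then show ?thesis using H tH V4 cV by (intro disjI2 disjI1 exI[of _ ?H]) simp
  qed
  show ?thesis
  proof (cases "{a, b} \<in> edges G \<and> {b, c} \<in> edges G \<and> {a, c} \<in> edges G")
    case False
    then show ?thesis using remove[of a b c] remove[of b c a] remove[of a c b] d by blast
  next
    case True
    let ?X = "{v, a, b, c}"
    let ?T = "{{a, b}, {b, c}, {a, c}}"
    have T: "card ?T = 3" using d by (simp add: doubleton_eq_iff)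
    have "?S \<inter> ?T = {}" using abc by auto
    then have "card (?S \<union> ?T) = 6" using v(2) T fin by (subst card_Un_disjoint) auto
    moreover have "?S \<union> ?T \<subseteq> induced (edges G) ?X"
      using True unfolding S using S by (auto simp: induced_def)
    ultimately have "6 \<le> card (induced (edges G) ?X)"
      using card_mono[OF finite_induced[OF fin(2)], of "?S \<union> ?T" ?X] by simp
    moreover have cX: "card ?X = 4" using abc d by auto
    moreover have sub: "?X \<subseteq> verts G" "?X \<noteq> {}" using v abc by auto
    then have "card (induced (edges G) ?X) + 2 \<le> 2 * card ?X"
      using t'(2) unfolding sparse22_def by blast
    ultimately have "card (induced (edges G) ?X) + 2 = 2 * card ?X" by linarith
    then have "tight_set G ?X" using sub unfolding tight_set_def by blast
    then have "?X = verts G" using none[of ?X] cX by fastforce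
    then have "is_K4 G" using is_K4_if_tight22[OF G t] cX by simp
    then show ?thesis by blast
  qed
qed

section \<open>Contracting a tight set\<close>

text \<open>Contractions are described by a map on vertices, so that the contracted vertex can be
  represented in two ways: by \<open>None\<close>, as in an extension move, and by a vertex of \<open>X\<close> itself, which
  stays in the same vertex type and thus allows induction.\<close>

definition collapses :: "('a \<Rightarrow> 'b) \<Rightarrow> 'a set \<Rightarrow> 'a set \<Rightarrow> bool" where
  "collapses q V X \<longleftrightarrow> (\<forall>u\<in>V. \<forall>v\<in>V. q u = q v \<longleftrightarrow> u = v \<or> u \<in> X \<and> v \<in> X)"

definition quotient :: "('a \<Rightarrow> 'b) \<Rightarrow> 'a graph \<Rightarrow> 'a set \<Rightarrow> 'b graph" where
  "quotient q G X =
     \<lparr>verts = q ` verts G, edges = (\<lambda>e. q ` e) ` (edges G - induced (edges G) X)\<rparr>"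

lemma outer_edgeE:
  assumes G: "simple_graph G" and e: "e \<in> edges G - induced (edges G) X"
  obtains u v where "e = {u, v}" "u \<noteq> v" "u \<in> verts G" "v \<in> verts G" "u \<notin> X \<or> v \<notin> X"
proof -
  have "card e = 2" "e \<subseteq> verts G" using G e by (auto simp: simple_graph_def)
  then obtain u v where uv: "e = {u, v}" "u \<noteq> v" by (auto simp: card_2_iff)
  moreover have "u \<notin> X \<or> v \<notin> X" using e uv by (auto simp: induced_def)
  ultimately show ?thesis using that \<open>e \<subseteq> verts G\<close> by blast
qed

lemma card_image_outer_edge:
  assumes G: "simple_graph G" and q: "collapses q (verts G) X"
    and e: "e \<in> edges G - induced (edges G) X"
  shows "card (q ` e) = 2"
proof -
  obtain u v where "e = {u, v}" "u \<noteq> v" "u \<in> verts G" "v \<in> verts G" "u \<notin> X \<or> v \<notin> X"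
    using outer_edgeE[OF G e] .
  moreover have "q u \<noteq> q v" using calculation q unfolding collapses_def by blast
  ultimately show ?thesis by simp
qed

text \<open>Two edges with the same image agree at an end outside \<open>X\<close>. If their other ends both lie in \<open>X\<close>,
  they are equal because an outside vertex sees \<open>X\<close> at most once.\<close>

lemma inj_on_outer_edges:
  assumes G: "simple_graph G" and q: "collapses q (verts G) X" and X: "single_links G X"
  shows "inj_on (\<lambda>e. q ` e) (edges G - induced (edges G) X)"
proof (rule inj_onI)
  fix e f assume e: "e \<in> edges G - induced (edges G) X" and f: "f \<in> edges G - induced (edges G) X"
    and eq: "q ` e = q ` f"
  obtain u v where uv: "e = {u, v}" "u \<noteq> v" "u \<in> verts G" "v \<in> verts G" "u \<notin> X \<or> v \<notin> X"
    using outer_edgeE[OF G e] .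
  obtain s t where st: "f = {s, t}" "s \<in> verts G" "t \<in> verts G" "q u = q s" "q v = q t"
  proof -
    obtain s t where st: "f = {s, t}" "s \<in> verts G" "t \<in> verts G"
      using outer_edgeE[OF G f] by metis
    then have "{q u, q v} = {q s, q t}" using eq uv by simp
    then have "q u = q s \<and> q v = q t \<or> q u = q t \<and> q v = q s" by (simp add: doubleton_eq_iff)
    then show ?thesis using st that[of s t] that[of t s] by (auto simp: insert_commute)
  qed
  have us: "u = s \<or> u \<in> X \<and> s \<in> X" using q uv st unfolding collapses_def by blast
  have vt: "v = t \<or> v \<in> X \<and> t \<in> X" using q uv st unfolding collapses_def by blast
  have edges: "{u, v} \<in> edges G" "{s, t} \<in> edges G" using e f uv st by auto
  show "e = f"
  proof (cases "u \<in> X")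
    case True
    then have v: "v \<in> verts G - X" "v = t" using uv vt by auto
    moreover have "s \<in> X" using us True by auto
    moreover have "{v, u} \<in> edges G" "{v, s} \<in> edges G"
      using edges v by (auto simp: insert_commute)
    ultimately have "u = s" using X True unfolding single_links_def by blast
    then show ?thesis using uv st v by simp
  next
    case False
    then have u: "u \<in> verts G - X" "u = s" using uv us by auto
    then have "v = t" using X vt edges unfolding single_links_def by blast
    then show ?thesis using uv st u by simp
  qed
qed

lemma card_image_collapses:
  assumes q: "collapses q V X" and Z: "finite Z" "Z \<subseteq> V"
  shows "Z \<inter> X = {} \<Longrightarrow> card (q ` Z) = card Z"
    and "X \<subseteq> Z \<Longrightarrow> X \<noteq> {} \<Longrightarrow> card (q ` Z) + card X = card Z + 1"
proof -
  have inj: "inj_on q (Z - X)" using q Z unfolding collapses_def inj_on_def by blast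
  then show "card (q ` Z) = card Z" if "Z \<inter> X = {}"
    using that by (simp add: card_image Diff_triv)
  assume X: "X \<subseteq> Z" "X \<noteq> {}"
  then obtain x where x: "x \<in> X" by blast
  have "q u = q x" if "u \<in> X" for u using q x X Z that unfolding collapses_def by blast
  then have "q ` X = {q x}" using x by blast
  moreover have "q ` Z = q ` X \<union> q ` (Z - X)" using X by blast
  ultimately have "q ` Z = insert (q x) (q ` (Z - X))" by simp
  moreover have "q x \<noteq> q u" if "u \<in> Z - X" for u
  proof -
    have "x \<in> V" "u \<in> V" "u \<notin> X" "x \<noteq> u" using that x X Z by auto
    then show ?thesis using q unfolding collapses_def by blast
  qed
  then have "q x \<notin> q ` (Z - X)" by blast
  moreover have "finite (q ` (Z - X))" using Z by simp
  ultimately have "card (q ` Z) = card (q ` (Z - X)) + 1" by simp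
  also have "card (q ` (Z - X)) = card (Z - X)" using inj by (rule card_image)
  also have "card (Z - X) = card Z - card X" using X Z by (simp add: card_Diff_subset finite_subset)
  finally show "card (q ` Z) + card X = card Z + 1" using card_mono[OF Z(1) X(1)] by simp
qed

lemma quotient_simple:
  assumes G: "simple_graph G" and q: "collapses q (verts G) X"
  shows "simple_graph (quotient q G X)"
proof -
  have "q ` e \<subseteq> q ` verts G" if "e \<in> edges G" for e
    using G that by (auto simp: simple_graph_def)
  then show ?thesis
    using G card_image_outer_edge[OF G q] unfolding quotient_def simple_graph_def by auto
qed

text \<open>A vertex set of the quotient has a preimage \<open>Z\<close> that either avoids \<open>X\<close> or contains it. In the
  second case the contraction removes \<open>2 * card X - 2\<close> edges and \<open>card X - 1\<close> vertices, which leaves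
  the freedom unchanged.\<close>

lemma quotient_tight22:
  assumes G: "simple_graph G" and t: "tight22 G" and X: "tight_set G X"
    and links: "single_links G X" and q: "collapses q (verts G) X"
  shows "tight22 (quotient q G X)"
proof -
  let ?V = "verts G" and ?E = "edges G"
  let ?R = "?E - induced ?E X"
  let ?F = "(\<lambda>e. q ` e) ` ?R"
  have fin: "finite ?V" "finite ?E" using G finite_edges by (auto simp: simple_graph_def)
  have t': "card ?E + 2 = 2 * card ?V" "sparse22 ?V ?E" using t tight22_iff[OF G] by auto
  have X': "X \<subseteq> ?V" "X \<noteq> {}" "card (induced ?E X) + 2 = 2 * card X"
    using X by (auto simp: tight_set_def)
  have cV: "card (q ` ?V) + card X = card ?V + 1"
    using card_image_collapses(2)[OF q fin(1) order_refl] X' by simp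
  have "card ?F = card ?R" using inj_on_outer_edges[OF G q links] by (rule card_image)
  also have "card ?R = card ?E - card (induced ?E X)"
    using fin by (intro card_Diff_subset) (auto simp: induced_def)
  finally have "card ?F + card (induced ?E X) = card ?E"
    using card_mono[OF fin(2), of "induced ?E X"] by (auto simp: induced_def)
  then have total: "card ?F + 2 = 2 * card (q ` ?V)" using t'(1) X'(3) cV by linarith
  have "sparse22 (q ` ?V) ?F"
    unfolding sparse22_def
  proof (intro allI impI)
    fix Y assume Y: "Y \<subseteq> q ` ?V" "Y \<noteq> {}"
    define Z where "Z = {v \<in> ?V. q v \<in> Y}"
    have Z: "Z \<subseteq> ?V" "Z \<noteq> {}" "q ` Z = Y" using Y by (auto simp: Z_def)
    have finZ: "finite Z" using Z(1) fin(1) by (rule finite_subset)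
    have finI: "finite (induced ?E Z)" using fin(2) by (rule finite_induced)
    have spZ: "card (induced ?E Z) + 2 \<le> 2 * card Z"
      using t'(2) Z by (simp add: sparse22_def)
    have "induced ?F Y \<subseteq> (\<lambda>e. q ` e) ` (induced ?E Z - induced ?E X)"
    proof
      fix f assume "f \<in> induced ?F Y"
      then obtain e where e: "e \<in> ?R" "f = q ` e" "q ` e \<subseteq> Y" by (auto simp: induced_def)
      then have "e \<subseteq> Z" using G by (auto simp: simple_graph_def Z_def)
      then show "f \<in> (\<lambda>e. q ` e) ` (induced ?E Z - induced ?E X)"
        using e by (auto simp: induced_def)
    qed
    then have le: "card (induced ?F Y) \<le> card (induced ?E Z - induced ?E X)"
      using finI by (intro surj_card_le) auto
    show "card (induced ?F Y) + 2 \<le> 2 * card Y"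
    proof (cases "Z \<inter> X = {}")
      case True
      then have "card Y = card Z" using card_image_collapses(1)[OF q finZ Z(1)] Z(3) by simp
      moreover have "card (induced ?E Z - induced ?E X) \<le> card (induced ?E Z)"
        using finI by (intro card_mono) auto
      ultimately show ?thesis using le spZ by linarith
    next
      case False
      then obtain z where z: "z \<in> ?V" "q z \<in> Y" "z \<in> X" by (auto simp: Z_def)
      have XZ: "X \<subseteq> Z"
      proof
        fix x assume "x \<in> X"
        then have "x \<in> ?V" "q x = q z" using q X'(1) z(1,3) unfolding collapses_def by blast+
        then show "x \<in> Z" using z(2) by (simp add: Z_def)
      qed
      then have "induced ?E X \<subseteq> induced ?E Z" by (auto simp: induced_def)
      then have "card (induced ?E Z - induced ?E X) + card (induced ?E X) = card (induced ?E Z)"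
        using card_Diff_subset[of "induced ?E X" "induced ?E Z"] card_mono[OF finI]
          finite_subset[OF _ finI] by simp
      moreover have "card Y + card X = card Z + 1"
        using card_image_collapses(2)[OF q finZ Z(1) XZ X'(2)] Z(3) by simp
      ultimately show ?thesis using le spZ X'(3) by linarith
    qed
  qed
  then show ?thesis
    using total tight22_iff[OF quotient_simple[OF G q]] by (simp add: quotient_def)
qed

lemma extension_move_induced_graph:
  assumes G: "simple_graph G" and t: "tight22 G" and X: "tight_set G X"
    and links: "single_links G X"
  shows "extension_move (induced_graph G X) G"
proof -
  let ?H = "induced_graph G X"
  let ?q = "contract_vertex ?H"
  have sub: "X \<subseteq> verts G" "X \<noteq> {}" using X by (auto simp: tight_set_def)
  have q: "collapses ?q (verts G) X" by (auto simp: collapses_def contract_vertex_def)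
  have "?q ` verts G = Some ` (verts G - X) \<union> {None}"
    using sub by (auto simp: contract_vertex_def image_iff)
  then have "graph_of (contraction G ?H) = quotient ?q G X"
    by (simp add: graph_of_def contraction_def quotient_def)
  then have "tight22 (graph_of (contraction G ?H))"
    using quotient_tight22[OF G t X links q] by simp
  moreover have "simple_multigraph (contraction G ?H)"
    using card_image_outer_edge[OF G q] inj_on_outer_edges[OF G q links]
    by (simp add: simple_multigraph_def contraction_def)
  moreover have "subgraph ?H G"
    using induced_graph_simple[OF G sub(1)] sub by (auto simp: subgraph_def induced_def)
  ultimately show ?thesis
    using G t induced_graph_tight22[OF G t X] by (simp add: extension_move_def)
qed

text \<open>A walk in the image lifts edge by edge. Where consecutive lifted edges fail to meet, their
  ends lie in a common fibre, and the only fibre with several vertices is \<open>X\<close>, which \<open>A\<close> connects.\<close>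

lemma connects_lift:
  assumes q: "collapses q V X" and A: "connects A X" and F: "connects F (q ` V)"
    and A_sub: "A \<subseteq> D" and F_sub: "\<And>f. f \<in> F \<Longrightarrow> \<exists>s\<in>V. \<exists>t\<in>V. {s, t} \<in> D \<and> f = {q s, q t}"
  shows "connects D V"
proof -
  have fibre: "joined D u v" if "u \<in> V" "v \<in> V" "q u = q v" for u v
  proof -
    have "u = v \<or> u \<in> X \<and> v \<in> X" using that q unfolding collapses_def by blast
    moreover have "joined A u v" if "u \<in> X" "v \<in> X" using A that unfolding connects_iff by blast
    ultimately show ?thesis using joined_mono[OF _ A_sub, of u v] by blast
  qed
  have walk: "joined D u v" if "joined F (q u) y" "u \<in> V" "v \<in> V" "q v = y" for u v y
    using that
  proof (induction arbitrary: v rule: rtranclp_induct)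
    case base
    then show ?case using fibre by simp
  next
    case (step y z)
    obtain s t where st: "s \<in> V" "t \<in> V" "{s, t} \<in> D" "{y, z} = {q s, q t}"
      using F_sub[OF step.hyps(2)] by blast
    \<comment> \<open>The edge is an unordered pair, so it may have to be traversed in the other direction.\<close>
    obtain s t where st: "s \<in> V" "t \<in> V" "{s, t} \<in> D" "q s = y" "q t = z"
    proof (cases "y = q s \<and> z = q t")
      case True
      then show ?thesis using st that by blast
    next
      case False
      then have "y = q t" "z = q s" using st(4) by (auto simp: doubleton_eq_iff)
      moreover have "{t, s} \<in> D" using st(3) by (simp add: insert_commute)
      ultimately show ?thesis using st that by blast
    qed
    have "joined D u s" using step.IH step.prems(1) st by blast
    moreover have "joined D s t" using st(3) by (rule joined_edge)
    moreover have "joined D t v" using fibre[of t v] st step.prems by simp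
    ultimately show ?case using rtranclp_trans[of _ u s t] rtranclp_trans[of _ u t v] by blast
  qed
  show ?thesis
    unfolding connects_iff
  proof (intro conjI ballI)
    show "V \<noteq> {}" using F by (auto simp: connects_iff)
    fix u v assume uv: "u \<in> V" "v \<in> V"
    then have "joined F (q u) (q v)" using F unfolding connects_iff by blast
    then show "joined D u v" using uv by (rule walk) simp
  qed
qed

section \<open>The equivalence\<close>

text \<open>Each class of the quotient is pulled back and completed by one class inside \<open>X\<close>.\<close>

lemma double_connected_if_quotient:
  assumes G: "simple_graph G" and X: "X \<subseteq> verts G" and q: "collapses q (verts G) X"
    and H: "double_connected (induced_graph G X)" and Q: "double_connected (quotient q G X)"
  shows "double_connected G"
proof -
  let ?R = "edges G - induced (edges G) X"
  obtain A1 A2 where A: "induced (edges G) X = A1 \<union> A2" "A1 \<inter> A2 = {}"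
    and A_con: "connects A1 X" "connects A2 X"
    using H by (auto simp: double_connected_def)
  obtain F1 F2 where F: "(\<lambda>e. q ` e) ` ?R = F1 \<union> F2" "F1 \<inter> F2 = {}"
    and F_con: "connects F1 (q ` verts G)" "connects F2 (q ` verts G)"
    using Q by (auto simp: double_connected_def quotient_def)
  have con: "connects (A \<union> {e \<in> ?R. q ` e \<in> F}) (verts G)"
    if "connects A X" and "connects F (q ` verts G)" and sub: "F \<subseteq> (\<lambda>e. q ` e) ` ?R" for A F
  proof (rule connects_lift[OF q that(1,2)])
    fix f assume f: "f \<in> F"
    then obtain e where e: "e \<in> ?R" "f = q ` e" using sub by blast
    obtain u v where "e = {u, v}" "u \<in> verts G" "v \<in> verts G" using outer_edgeE[OF G e(1)] .
    then show "\<exists>s\<in>verts G. \<exists>t\<in>verts G. {s, t} \<in> A \<union> {e \<in> ?R. q ` e \<in> F} \<and> f = {q s, q t}"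
      using e f by (intro bexI[of _ u] bexI[of _ v]) auto
  qed simp
  let ?E1 = "A1 \<union> {e \<in> ?R. q ` e \<in> F1}" and ?E2 = "A2 \<union> {e \<in> ?R. q ` e \<in> F2}"
  have "induced (edges G) X \<subseteq> edges G" by (auto simp: induced_def)
  then have "edges G = ?E1 \<union> ?E2" using A(1) F(1) by blast
  moreover have "?E1 \<inter> ?E2 = {}" using A F(2) by blast
  moreover have "connects ?E1 (verts G)" using A_con(1) F_con(1) F(1) by (intro con) auto
  moreover have "connects ?E2 (verts G)" using A_con(2) F_con(2) F(1) by (intro con) auto
  ultimately show ?thesis by (rule double_connectedI)
qed

text \<open>A proper tight set with at least two vertices has fewer vertices than \<open>G\<close>, and so has its
  quotient. Induction applies to both, with the contracted set represented by one of its vertices.\<close>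

lemma tight22_imp_double_connected:
  assumes "simple_graph G" and "tight22 G"
  shows "double_connected G"
  using assms
proof (induction "card (verts G)" arbitrary: G rule: less_induct)
  case less
  note G = less.prems(1) and t = less.prems(2)
  have fin: "finite (verts G)" using G by (simp add: simple_graph_def)
  have count: "card (edges G) + 2 = 2 * card (verts G)" using t tight22_iff[OF G] by simp
  show ?case
  proof (cases "card (verts G) \<ge> 2")
    case False
    then have "card (verts G) = 1" "card (edges G) = 0" using count by auto
    then obtain v where "verts G = {v}" "edges G = {}"
      using finite_edges[OF G] by (auto simp: card_1_singleton_iff)
    then show ?thesis by (intro double_connectedI[of _ "{}" "{}"]) (auto simp: connects_iff)
  next
    case True
    consider "is_K4 G"
      | H where "simple_graph H" "tight22 H" "card (verts H) < card (verts G)"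
        "henneberg1 H G \<or> henneberg2 H G"
      | X where "tight_set G X" "X \<noteq> verts G" "2 \<le> card X" "single_links G X"
      using tight22_cases[OF G t True] by blast
    then show ?thesis
    proof cases
      case 1
      then show ?thesis by (rule double_connected_K4)
    next
      case 2
      then have "double_connected H" using less.hyps by blast
      then show ?thesis
        using 2 double_connected_henneberg1 double_connected_henneberg2 by blast
    next
      case 3
      then have X: "X \<subseteq> verts G" "X \<noteq> {}" by (auto simp: tight_set_def)
      then obtain h where h: "h \<in> X" by blast
      define q where "q v = (if v \<in> X then h else v)" for v
      have q: "collapses q (verts G) X" using h by (auto simp: collapses_def q_def)
      have "card (q ` verts G) + card X = card (verts G) + 1"
        using card_image_collapses(2)[OF q fin order_refl X] .
      then have "card (verts (quotient q G X)) < card (verts G)"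
        using 3(3) by (simp add: quotient_def)
      then have "double_connected (quotient q G X)"
        using less.hyps quotient_simple[OF G q] quotient_tight22[OF G t 3(1,4) q] by blast
      moreover have "card X < card (verts G)" using X 3(2) fin by (intro psubset_card_mono) auto
      then have "double_connected (induced_graph G X)"
        using less.hyps[of "induced_graph G X"] induced_graph_simple[OF G X(1)]
          induced_graph_tight22[OF G t 3(1)] by simp
      ultimately show ?thesis using double_connected_if_quotient[OF G X(1) q] by blast
    qed
  qed
qed

lemma tight22_imp_derivable:
  assumes "simple_graph G" and "tight22 G" and "card (verts G) \<ge> 2"
  shows "derivable_from_K4 G"
  using assms
proof (induction "card (verts G)" arbitrary: G rule: less_induct)
  case less
  note G = less.prems(1) and t = less.prems(2)
  have step: ?case if "derivable_from_K4 H" "construction_move H G" for H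
    using that unfolding derivable_from_K4_def by (meson rtranclp.rtrancl_into_rtrancl)
  consider "is_K4 G"
    | H where "simple_graph H" "tight22 H" "2 \<le> card (verts H)" "card (verts H) < card (verts G)"
      "henneberg1 H G \<or> henneberg2 H G"
    | X where "tight_set G X" "X \<noteq> verts G" "2 \<le> card X" "single_links G X"
    using tight22_cases[OF G t less.prems(3)] by blast
  then show ?case
  proof cases
    case 1
    then show ?thesis unfolding derivable_from_K4_def by blast
  next
    case 2
    then have "derivable_from_K4 H" using less.hyps by blast
    then show ?thesis using step[of H] 2(5) unfolding construction_move_def by blast
  next
    case 3
    then have X: "X \<subseteq> verts G" by (simp add: tight_set_def)
    have "finite (verts G)" using G by (simp add: simple_graph_def)
    then have "card X < card (verts G)" using X 3(2) by (intro psubset_card_mono) auto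
    then have "derivable_from_K4 (induced_graph G X)"
      using less.hyps[of "induced_graph G X"] induced_graph_simple[OF G X]
        induced_graph_tight22[OF G t 3(1)] 3(3) by simp
    then show ?thesis
      using step extension_move_induced_graph[OF G t 3(1,4)] unfolding construction_move_def by blast
  qed
qed

theorem theorem2p13:
  fixes G :: "'a graph"
  assumes "simple_graph G"
    and "connected_graph G"
    and "edges G \<noteq> {}"
  shows "(tight22 G \<longleftrightarrow> two_spanning_trees G) \<and> (two_spanning_trees G \<longleftrightarrow> derivable_from_K4 G)"
proof -
  have "two_spanning_trees G" if "tight22 G"
    using two_spanning_trees_if_double_connected[OF assms(1)] that
      tight22_imp_double_connected[OF assms(1)] tight22_iff[OF assms(1)] by blast
  moreover have "tight22 G" if "two_spanning_trees G"
    using assms(1) that by (rule two_spanning_trees_imp_tight22)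
  moreover have "derivable_from_K4 G" if "tight22 G"
  proof -
    obtain e where "e \<in> edges G" using assms(3) by blast
    then have "card e = 2" "e \<subseteq> verts G" using assms(1) by (auto simp: simple_graph_def)
    then have "card (verts G) \<ge> 2"
      using assms(1) card_mono[of "verts G" e] by (simp add: simple_graph_def)
    then show ?thesis using assms(1) that by (intro tight22_imp_derivable)
  qed
  moreover have "tight22 G" if "derivable_from_K4 G"
    using that by (rule derivable_imp_tight22)
  ultimately show ?thesis by blast
qed

end
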